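(* Let $L=\langle R_i : i\in I\rangle$ be a relational language, let $\mathbb X$ be an $L$-structure with domain $X$ of size $\kappa$ and let $\lambda$ be a regular cardinal, where $\omega\leq\lambda\leq\kappa$. Let $\mathrm{cl}$ be a closure operator on $P(X)$ and let $\varphi^*\in\mathrm{Pc}^{<\lambda}(\mathbb X)$ be a bad condensation such that $\mathrm{cl}(\mathrm{dom}(\varphi^* ))=\mathrm{dom}(\varphi^* )$. If the set $$\Pi:=\{\varphi\in\mathrm{Pc}^{<\kappa}_{\varphi^*}(\mathbb X):\mathrm{cl}(\mathrm{dom}(\varphi))=\mathrm{dom}(\varphi)\}$$ satisfies the conditions (bf1$_\lambda$) $\forall\varphi\in\Pi\ \forall a\in X\ \exists\psi\in\Pi\ (\varphi\subset\psi\wedge a\in\mathrm{dom}\,\psi\wedge|\psi\setminus\varphi|<\lambda)$, (bf2$_\lambda$) $\forall\varphi\in\Pi\ \forall b\in X\ \exists\psi\in\Pi\ (\varphi\subset\psi\wedge b\in\mathrm{ran}\,\psi\wedge|\psi\setminus\varphi|<\lambda)$, then $\mathbb X$ is not reversible.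
   Context: $L=\langle R_i:i\in I\rangle$ is a relational language with $\mathrm{ar}(R_i)=n_i\in\mathbb N=\{1,2,\dots\}$. The symbol $\subset$ denotes (not necessarily proper) inclusion; $P(X)$ is the power set of $X$. An $L$-structure $\mathbb X$ with domain $X$ is reversible iff each bijective homomorphism $f:\mathbb X\to\mathbb X$ is an automorphism of $\mathbb X$. A function $\varphi$ is a partial condensation of $\mathbb X$, written $\varphi\in\mathrm{Pc}(\mathbb X)$, iff $\varphi$ is a bijection from $\mathrm{dom}(\varphi)\subset X$ onto $\mathrm{ran}(\varphi)\subset X$ and for all $i\in I$ and all $\bar x\in(\mathrm{dom}\,\varphi)^{n_i}$: $\bar x\in R_i^{\mathbb X}\Rightarrow \varphi\bar x\in R_i^{\mathbb X}$ ($\varphi$ applied coordinatewise). A partial condensation $\varphi^*$ is bad iff there are $i\in I$ and $\bar x\in(\mathrm{dom}\,\varphi^* )^{n_i}$ with $\bar x\notin R_i^{\mathbb X}$ and $\varphi^*\bar x\in R_i^{\mathbb X}$. For a cardinal $\mu$, $\mathrm{Pc}^{<\mu}(\mathbb X)=\{\varphi\in\mathrm{Pc}(\mathbb X):|\varphi|<\mu\}$ and $\mathrm{Pc}^{<\mu}_{\varphi^*}(\mathbb X)=\{\varphi\in\mathrm{Pc}^{<\mu}(\mathbb X):\varphi^*\subset\varphi\}$. If $X$ is a set of size $\kappa\geq\omega$, a mapping $\mathrm{cl}:P(X)\to P(X)$ is called a closure operator on $P(X)$ iff (cl1) $S\subset\mathrm{cl}(S)$ for each $S\subset X$; (cl2)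 $\mathrm{cl}(\bigcup_{i\in J}S_i)=\bigcup_{i\in J}\mathrm{cl}(S_i)$ whenever $|J|<\kappa$ and $|S_i|<\kappa$ for all $i\in J$. *)

theory Defs
  imports Main "HOL-Library.NList"
begin

unbundle cardinal_syntax

(* A relational language is an index set I together with arities ar i >= 1; an n-tuple over X is
   an element of nlists n X.  A structure for it is a domain X together with R i \<subseteq> X^(ar i). *)

definition relational_language :: "'i set \<Rightarrow> ('i \<Rightarrow> nat) \<Rightarrow> bool" where
  "relational_language I ar \<longleftrightarrow> (\<forall>i\<in>I. 1 \<le> ar i)"

definition rel_structure ::
    "'i set \<Rightarrow> ('i \<Rightarrow> nat) \<Rightarrow> 'a set \<Rightarrow> ('i \<Rightarrow> 'a list set) \<Rightarrow> bool" where
  "rel_structure I ar X R \<longleftrightarrow> (\<forall>i\<in>I. R i \<subseteq> nlists (ar i) X)"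

definition homomorphism ::
    "'i set \<Rightarrow> ('i \<Rightarrow> nat) \<Rightarrow> 'a set \<Rightarrow> ('i \<Rightarrow> 'a list set) \<Rightarrow> ('a \<Rightarrow> 'a) \<Rightarrow> bool" where
  "homomorphism I ar X R f \<longleftrightarrow>
     f ` X \<subseteq> X \<and> (\<forall>i\<in>I. \<forall>xs\<in>nlists (ar i) X. xs \<in> R i \<longrightarrow> map f xs \<in> R i)"

definition automorphism ::
    "'i set \<Rightarrow> ('i \<Rightarrow> nat) \<Rightarrow> 'a set \<Rightarrow> ('i \<Rightarrow> 'a list set) \<Rightarrow> ('a \<Rightarrow> 'a) \<Rightarrow> bool" where
  "automorphism I ar X R f \<longleftrightarrow>
     bij_betw f X X \<and> (\<forall>i\<in>I. \<forall>xs\<in>nlists (ar i) X. xs \<in> R i \<longleftrightarrow> map f xs \<in> R i)"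

definition reversible ::
    "'i set \<Rightarrow> ('i \<Rightarrow> nat) \<Rightarrow> 'a set \<Rightarrow> ('i \<Rightarrow> 'a list set) \<Rightarrow> bool" where
  "reversible I ar X R \<longleftrightarrow>
     (\<forall>f. bij_betw f X X \<and> homomorphism I ar X R f \<longrightarrow> automorphism I ar X R f)"

(* Partial maps are represented by their graphs, so that \<phi> \<subseteq> \<psi>, \<psi> - \<phi> and |\<phi>| are the
   set-theoretic notions.  For the graph \<phi> of a map, (xs, ys) \<in> listrel \<phi> says that the entries of
   xs lie in the domain and that ys is the coordinatewise image of xs. *)

definition Pc ::
    "'i set \<Rightarrow> ('i \<Rightarrow> nat) \<Rightarrow> 'a set \<Rightarrow> ('i \<Rightarrow> 'a list set) \<Rightarrow> 'a rel set" where
  "Pc I ar X R =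
     {\<phi>. Domain \<phi> \<subseteq> X \<and> Range \<phi> \<subseteq> X \<and> single_valued \<phi> \<and> single_valued (\<phi>\<inverse>) \<and>
         (\<forall>i\<in>I. \<forall>xs\<in>nlists (ar i) (Domain \<phi>). \<forall>ys.
            (xs, ys) \<in> listrel \<phi> \<longrightarrow> xs \<in> R i \<longrightarrow> ys \<in> R i)}"

definition bad_condensation ::
    "'i set \<Rightarrow> ('i \<Rightarrow> nat) \<Rightarrow> 'a set \<Rightarrow> ('i \<Rightarrow> 'a list set) \<Rightarrow> 'a rel \<Rightarrow> bool" where
  "bad_condensation I ar X R \<phi> \<longleftrightarrow>
     \<phi> \<in> Pc I ar X R \<and>
     (\<exists>i\<in>I. \<exists>xs\<in>nlists (ar i) (Domain \<phi>). \<exists>ys.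
        (xs, ys) \<in> listrel \<phi> \<and> xs \<notin> R i \<and> ys \<in> R i)"

definition Pc_less ::
    "'i set \<Rightarrow> ('i \<Rightarrow> nat) \<Rightarrow> 'a set \<Rightarrow> ('i \<Rightarrow> 'a list set) \<Rightarrow> 'm rel \<Rightarrow> 'a rel set" where
  "Pc_less I ar X R \<mu> = {\<phi> \<in> Pc I ar X R. |\<phi>| <o \<mu>}"

definition Pc_less_above ::
    "'i set \<Rightarrow> ('i \<Rightarrow> nat) \<Rightarrow> 'a set \<Rightarrow> ('i \<Rightarrow> 'a list set) \<Rightarrow> 'm rel \<Rightarrow> 'a rel \<Rightarrow> 'a rel set" where
  "Pc_less_above I ar X R \<mu> \<phi>s = {\<phi> \<in> Pc_less I ar X R \<mu>. \<phi>s \<subseteq> \<phi>}"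

(* Index sets J are taken in the type 'a of elements of X; since |J| <o |X| is required, this is
   no restriction: every such index set is in bijection with a subset of X. *)

definition closure_operator :: "'a set \<Rightarrow> ('a set \<Rightarrow> 'a set) \<Rightarrow> bool" where
  "closure_operator X cl \<longleftrightarrow>
     cl ` Pow X \<subseteq> Pow X \<and>
     (\<forall>S. S \<subseteq> X \<longrightarrow> S \<subseteq> cl S) \<and>
     (\<forall>(J :: 'a set) (S :: 'a \<Rightarrow> 'a set).
        |J| <o |X| \<and> (\<forall>j\<in>J. S j \<subseteq> X \<and> |S j| <o |X| ) \<longrightarrow>
        cl (\<Union>j\<in>J. S j) = (\<Union>j\<in>J. cl (S j)))"

end

theory Submission
  imports Defs
begin

text \<open>
  Well-order the domain in order type \<open>\<kappa>\<close> and build an increasing chain in \<open>\<Pi>\<close>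
  of length \<open>\<kappa>\<close>, starting from \<open>\<phi>\<^sup>*\<close>, whose \<open>a\<close>-th member has \<open>a\<close> in its domain and range.
  Each step adds fewer than \<open>\<lambda>\<close> pairs, so the union of the chain before stage \<open>a\<close> is a union of
  fewer than \<open>\<kappa>\<close> sets of size less than \<open>\<lambda>\<close>. Such a union has size less than \<open>\<kappa>\<close>
  (by regularity if \<open>\<lambda> = \<kappa>\<close>), and its domain is closed by (cl2), so the construction never stops.
  As relations are finitary, the union of the whole chain is a bijective endomorphism, and it
  extends the bad \<open>\<phi>\<^sup>*\<close>, hence is no automorphism.
\<close>

lemma Cinfinite_if_natLeq:
  assumes "Card_order r" "natLeq \<le>o r"
  shows "Cinfinite r"
  using assms cinfinite_mono[OF assms(2)] natLeq_Cinfinite by simp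

text \<open>If \<open>lam\<close> is strictly below \<open>|X|\<close>, the larger of
  \<open>lam\<close> and \<open>|J|\<close> bounds the union, and both are below \<open>|X|\<close>;
  this covers singular \<open>|X|\<close> as well. If the two cardinals coincide, \<open>|X|\<close>
  inherits regularity from \<open>lam\<close>.\<close>

lemma card_of_UNION_ordLess_regular:
  assumes "Card_order lam" "regularCard lam" "natLeq \<le>o lam" "lam \<le>o |X|"
    and J: "|J| <o |X|" and D: "\<And>j. j \<in> J \<Longrightarrow> |D j| <o lam"
  shows "|\<Union>j\<in>J. D j| <o |X|"
proof -
  have inf: "Cinfinite lam"
    using assms(1,3) by (rule Cinfinite_if_natLeq)
  show ?thesis
  proof (cases "lam =o |X|")
    case True
    then have "regularCard |X|" and infX: "Cinfinite |X|"
      using regularCard_ordIso inf assms(2) Cinfinite_cong by blast+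
    then show ?thesis
      using J D True by (intro card_of_UNION_ordLess_infinite_Field_regularCard)
        (auto intro: ordLess_ordIso_trans)
  next
    case False
    then have lt: "lam <o |X|" using assms(4) ordLeq_iff_ordLess_or_ordIso by blast
    show ?thesis
    proof (cases "|J| \<le>o lam")
      case True
      then have "|\<Union>j\<in>J. D j| \<le>o lam"
        using D inf by (intro UNION_Cinfinite_bound) (auto intro: ordLess_imp_ordLeq)
      then show ?thesis using lt ordLeq_ordLess_trans by blast
    next
      case False
      then have "lam \<le>o |J|"
        using assms(1) card_of_Well_order card_order_on_well_order_on not_ordLeq_iff_ordLess ordLess_imp_ordLeq
        by blast
      then have "Cinfinite |J|" using inf cinfinite_mono card_of_Card_order by blast
      then have "|\<Union>j\<in>J. D j| \<le>o |J|"
        using D \<open>lam \<le>o |J|\<close>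
        by (intro UNION_Cinfinite_bound)
          (auto intro: ordLess_imp_ordLeq ordLess_ordLeq_trans card_of_mono1)
      then show ?thesis using J ordLeq_ordLess_trans by blast
    qed
  qed
qed

text \<open>The recursion is separated from partial condensations: \<open>Q a\<close> is the task to
  be met at stage \<open>a\<close>. Since \<open>lim\<close> asks only for unions already known to
  be small, the size of each limit has to be controlled inside the construction.\<close>

lemma transfinite_chain:
  fixes X :: "'a set" and \<Pi> :: "'b set set" and Q :: "'a \<Rightarrow> 'b set \<Rightarrow> bool"
  assumes lam: "Card_order lam" "regularCard lam" "natLeq \<le>o lam" "lam \<le>o |X|"
    and base: "\<phi>s \<in> \<Pi>" "|\<phi>s| <o lam" and least: "\<And>\<phi>. \<phi> \<in> \<Pi> \<Longrightarrow> \<phi>s \<subseteq> \<phi>"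
    and step: "\<And>\<phi> a. \<phi> \<in> \<Pi> \<Longrightarrow> a \<in> X \<Longrightarrow> \<exists>\<psi>\<in>\<Pi>. \<phi> \<subseteq> \<psi> \<and> Q a \<psi> \<and> |\<psi> - \<phi>| <o lam"
    and lim: "\<And>J F. J \<noteq> {} \<Longrightarrow> J \<subseteq> X \<Longrightarrow> |J| <o |X| \<Longrightarrow> subset.chain \<Pi> (F ` J) \<Longrightarrow>
      |\<Union>j\<in>J. F j| <o |X| \<Longrightarrow> (\<Union>j\<in>J. F j) \<in> \<Pi>"
  obtains F where "subset.chain \<Pi> (F ` X)" "\<And>a. a \<in> X \<Longrightarrow> Q a (F a)"
proof -
  \<comment> \<open>As a relation, \<open>|X|\<close> is a well-order of \<open>X\<close> of least
    possible type, so every \<open>underS r a\<close> has fewer than \<open>|X|\<close>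
    elements.\<close>
  define r where "r = |X|"
  have wo: "well_order_on X r" unfolding r_def by (rule card_of_well_order_on)
  then have wf: "wf (r - Id)" and tr: "trans r" and anti: "antisym r" and tot: "total_on X r"
    and rX: "r \<subseteq> X \<times> X"
    by (auto simp: order_on_defs)
  define nxt where "nxt a \<phi> = (SOME \<psi>. \<psi> \<in> \<Pi> \<and> \<phi> \<subseteq> \<psi> \<and> Q a \<psi> \<and> |\<psi> - \<phi>| <o lam)" for a \<phi>
  \<comment> \<open>Adjoining \<open>\<phi>s\<close> only matters at the first stage, where the
    union is empty; later stages contain it anyway.\<close>
  define before where "before F a = \<phi>s \<union> (\<Union>b\<in>underS r a. F b)" for F :: "'a \<Rightarrow> 'b set" and a
  define F where "F = wfrec (r - Id) (\<lambda>F a. nxt a (before F a))"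
  define P where "P = before F"
  have "adm_wf (r - Id) (\<lambda>F a. nxt a (before F a))"
    unfolding adm_wf_def before_def underS_def
    by (intro allI impI arg_cong2[where f="nxt"] arg_cong2[where f="(\<union>)"] refl SUP_cong) auto
  from wfrec_fixpoint[OF wf this] have F: "F a = nxt a (P a)" for a
    unfolding F_def P_def by (rule fun_cong)
  \<comment> \<open>Sizes are counted through these increments, each below \<open>lam\<close>. A
    bound below \<open>|X|\<close> on the stages alone would not pass to limits when
    \<open>|X|\<close> is singular.\<close>
  define D where "D a = F a - P a" for a
  have F_D: "F a \<subseteq> \<phi>s \<union> (\<Union>b\<in>insert a (underS r a). D b)" for a
  proof (induction a rule: wf_induct_rule[OF wf])
    case (1 a)
    have "F b \<subseteq> \<phi>s \<union> (\<Union>c\<in>underS r a. D c)" if "b \<in> underS r a" for b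
    proof -
      have "insert b (underS r b) \<subseteq> underS r a"
        using that tr anti unfolding underS_def by (auto dest: transD antisymD)
      then show ?thesis using 1[of b] that by (fastforce simp: underS_def)
    qed
    then have "P a \<subseteq> \<phi>s \<union> (\<Union>c\<in>underS r a. D c)" unfolding P_def before_def by blast
    then show ?case unfolding D_def by blast
  qed
  \<comment> \<open>The choice in \<open>nxt\<close> is meaningful only once \<open>P a\<close> lies
    in \<open>\<Pi>\<close>, and this depends on all earlier stages; hence a joint
    induction.\<close>
  have main: "F a \<in> \<Pi> \<and> P a \<subseteq> F a \<and> Q a (F a) \<and> |D a| <o lam" if "a \<in> X" for a
    using that
  proof (induction a rule: wf_induct_rule[OF wf])
    case (1 a)
    let ?U = "underS r a"
    have UX: "?U \<subseteq> X" using rX by (auto simp: underS_def)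
    have IH: "F b \<in> \<Pi>" "P b \<subseteq> F b" "|D b| <o lam" if "b \<in> ?U" for b
      using 1(1)[of b] that UX by (auto simp: underS_def)
    have cU: "|?U| <o |X|"
      using 1(2) card_of_underS[OF card_of_Card_order, of a X] by (simp add: r_def Field_card_of)
    have "P a \<in> \<Pi>"
    proof (cases "?U = {}")
      case True
      then show ?thesis using base by (simp add: P_def before_def)
    next
      case False
      then have Pa: "P a = (\<Union>b\<in>?U. F b)"
        unfolding P_def before_def using IH(1) least by blast
      have "subset.chain \<Pi> (F ` ?U)"
        unfolding subset_chain_def
      proof (intro conjI ballI)
        fix A B assume "A \<in> F ` ?U" "B \<in> F ` ?U"
        then obtain b c where bc: "A = F b" "B = F c" "b \<in> ?U" "c \<in> ?U" by blast
        then have "b \<in> underS r c \<or> b = c \<or> c \<in> underS r b"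
          using tot UX unfolding total_on_def underS_def by blast
        \<comment> \<open>An earlier stage is part of \<open>P y\<close>, which stage
          \<open>y\<close> extends.\<close>
        moreover have "F x \<subseteq> F y" if "x \<in> underS r y" "y \<in> ?U" for x y
          using IH(2)[OF that(2)] that(1) unfolding P_def before_def by blast
        ultimately show "A \<subseteq> B \<or> B \<subseteq> A" using bc by blast
      qed (use IH(1) in blast)
      moreover have "|P a| <o |X|"
      proof -
        have "P a \<subseteq> \<phi>s \<union> (\<Union>b\<in>?U. D b)"
          unfolding Pa
        proof (rule UN_least)
          fix b assume b: "b \<in> ?U"
          have "insert b (underS r b) \<subseteq> ?U"
            using b tr anti unfolding underS_def by (auto dest: transD antisymD)
          then show "F b \<subseteq> \<phi>s \<union> (\<Union>b\<in>?U. D b)" using F_D[of b] by blast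
        qed
        moreover have "|\<Union>b\<in>?U. D b| <o |X|"
          using card_of_UNION_ordLess_regular[OF lam cU] IH(3) by blast
        moreover have "|\<phi>s| <o |X|" using base(2) lam(4) ordLess_ordLeq_trans by blast
        moreover have "infinite X"
          using lam(3,4) infinite_iff_natLeq_ordLeq ordLeq_transitive by blast
        ultimately show ?thesis
          by (meson card_of_Un_ordLess_infinite card_of_mono1 ordLeq_ordLess_trans)
      qed
      ultimately show ?thesis using lim[OF False UX cU] Pa by simp
    qed
    from someI_ex[OF step[OF this 1(2), unfolded Bex_def]] show ?case
      unfolding D_def F nxt_def .
  qed
  have "subset.chain \<Pi> (F ` X)"
    unfolding subset_chain_def
  proof (intro conjI ballI)
    fix A B assume "A \<in> F ` X" "B \<in> F ` X"
    then obtain b c where bc: "A = F b" "B = F c" "b \<in> X" "c \<in> X" by blast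
    then have "b \<in> underS r c \<or> b = c \<or> c \<in> underS r b"
      using tot unfolding total_on_def underS_def by blast
    moreover have "F x \<subseteq> F y" if "x \<in> underS r y" "y \<in> X" for x y
      using main[OF that(2)] that(1) unfolding P_def before_def by blast
    ultimately show "A \<subseteq> B \<or> B \<subseteq> A" using bc by blast
  qed (use main in blast)
  with main that show thesis by blast
qed

lemma single_valued_Union_chain:
  assumes "subset.chain \<A> C" "\<And>\<phi>. \<phi> \<in> C \<Longrightarrow> single_valued \<phi>"
  shows "single_valued (\<Union>C)"
proof (rule single_valuedI)
  fix x y z assume "(x, y) \<in> \<Union>C" "(x, z) \<in> \<Union>C"
  then obtain \<phi> \<psi> where "\<phi> \<in> C" "\<psi> \<in> C" "(x, y) \<in> \<phi>" "(x, z) \<in> \<psi>" by blast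
  moreover from this have "\<phi> \<subseteq> \<psi> \<or> \<psi> \<subseteq> \<phi>" using assms(1) by (auto simp: subset_chain_def)
  ultimately show "y = z" using assms(2) by (meson single_valuedD subsetD)
qed

text \<open>A tuple and its image involve only finitely many pairs, and a finite subset of the union
  of a nonempty chain lies in one member.\<close>

lemma listrel_Union_chain:
  assumes "subset.chain \<A> C" "C \<noteq> {}" "(xs, ys) \<in> listrel (\<Union>C)"
  obtains \<phi> where "\<phi> \<in> C" "(xs, ys) \<in> listrel \<phi>"
proof -
  have "set (zip xs ys) \<subseteq> \<Union>C" using assms(3) by (auto simp: listrel_iff_zip)
  then obtain \<phi> where "\<phi> \<in> C" "set (zip xs ys) \<subseteq> \<phi>"
    using finite_subset_Union_chain[OF _ _ assms(2,1)] by blast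
  then show thesis using that assms(3) by (auto simp: listrel_iff_zip)
qed

lemma listrel_set_Domain: "(xs, ys) \<in> listrel \<phi> \<Longrightarrow> set xs \<subseteq> Domain \<phi>"
  by (induction rule: listrel.induct) auto

text \<open>Serves both the limit stages and the final union, so the length of the chain is not
  restricted.\<close>

lemma Pc_Union_chain:
  assumes C: "subset.chain (Pc I ar X R) C" "C \<noteq> {}"
  shows "\<Union>C \<in> Pc I ar X R"
proof -
  have sub: "\<phi> \<in> Pc I ar X R" if "\<phi> \<in> C" for \<phi>
    using C(1) that by (auto simp: subset_chain_def)
  have "single_valued (\<Union>C)"
    using single_valued_Union_chain[OF C(1)] sub by (auto simp: Pc_def)
  moreover have "single_valued ((\<Union>C)\<inverse>)"
  proof -
    \<comment> \<open>Injectivity is single-valuedness of the converses, which again form a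
      chain.\<close>
    have "subset.chain UNIV (converse ` C)"
      using C(1) by (simp add: subset_chain_def converse_mono)
    then have "single_valued (\<Union>(converse ` C))"
      by (rule single_valued_Union_chain) (use sub in \<open>auto simp: Pc_def\<close>)
    then show ?thesis using converse_UNION[of id C] by simp
  qed
  moreover have "Domain (\<Union>C) \<subseteq> X" "Range (\<Union>C) \<subseteq> X"
    using sub unfolding Pc_def by blast+
  moreover have "ys \<in> R i"
    if i: "i \<in> I" "xs \<in> nlists (ar i) (Domain (\<Union>C))" "(xs, ys) \<in> listrel (\<Union>C)" "xs \<in> R i"
    for i xs ys
  proof -
    obtain \<phi> where \<phi>: "\<phi> \<in> C" "(xs, ys) \<in> listrel \<phi>"
      by (rule listrel_Union_chain[OF C i(3)])
    have "xs \<in> nlists (ar i) (Domain \<phi>)"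
      using nlistsE_length[OF i(2)] listrel_set_Domain[OF \<phi>(2)] by (rule nlistsI)
    then show ?thesis using sub[OF \<phi>(1)] \<phi>(2) i(1,4) unfolding Pc_def by blast
  qed
  ultimately show ?thesis unfolding Pc_def by blast
qed

text \<open>Such a relation is the graph of a bijective endomorphism, and the tuple witnessing
  badness breaks the equivalence demanded of an automorphism.\<close>

lemma not_reversible_if_total_bad_condensation:
  assumes bad: "bad_condensation I ar X R \<phi>" and dom: "Domain \<phi> = X" and ran: "Range \<phi> = X"
  shows "\<not> reversible I ar X R"
proof -
  have Pc: "\<phi> \<in> Pc I ar X R" using bad by (simp add: bad_condensation_def)
  then have sv: "single_valued \<phi>" "single_valued (\<phi>\<inverse>)" by (auto simp: Pc_def)
  \<comment> \<open>Values of \<open>f\<close> outside \<open>X\<close> are arbitrary; homomorphisms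
    and automorphisms are tested on \<open>X\<close> only.\<close>
  obtain f where f: "\<And>x. x \<in> X \<Longrightarrow> (x, f x) \<in> \<phi>" using dom bchoice[of X "\<lambda>x y. (x, y) \<in> \<phi>"] by blast
  then have f_iff: "(x, y) \<in> \<phi> \<longleftrightarrow> x \<in> X \<and> y = f x" for x y
    using dom sv(1) by (auto dest: single_valuedD)
  have bij: "bij_betw f X X"
  proof (rule bij_betw_imageI)
    show "inj_on f X"
      using sv(2) f by (intro inj_onI) (metis converse_iff single_valuedD)
    show "f ` X = X"
      using ran f_iff by blast
  qed
  have lr: "(xs, ys) \<in> listrel \<phi> \<longleftrightarrow> ys = map f xs" if "xs \<in> nlists n X" for xs ys n
    using that unfolding nlists_def
    by (auto simp: listrel_iff_nth f_iff list_eq_iff_nth_eq)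
  have "homomorphism I ar X R f"
    unfolding homomorphism_def
  proof (intro conjI ballI impI)
    show "f ` X \<subseteq> X" using bij by (simp add: bij_betw_def)
    fix i xs assume "i \<in> I" "xs \<in> nlists (ar i) X" "xs \<in> R i"
    then show "map f xs \<in> R i" using Pc lr[of xs "ar i" "map f xs"] dom by (simp add: Pc_def)
  qed
  moreover have "\<not> automorphism I ar X R f"
  proof -
    obtain i xs ys where "i \<in> I" "xs \<in> nlists (ar i) X" "(xs, ys) \<in> listrel \<phi>" "xs \<notin> R i" "ys \<in> R i"
      using bad unfolding bad_condensation_def dom by (elim conjE bexE exE)
    moreover from this have "ys = map f xs" using lr by simp
    ultimately show ?thesis unfolding automorphism_def by metis
  qed
  ultimately show ?thesis using bij unfolding reversible_def by blast
qed

theorem theorem3p3: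
  fixes I :: "'i set" and ar :: "'i \<Rightarrow> nat"
    and X :: "'a set" and R :: "'i \<Rightarrow> 'a list set"
    and lam :: "'l rel"
    and cl :: "'a set \<Rightarrow> 'a set"
    and \<phi>s :: "'a rel" and \<Pi> :: "'a rel set"
  assumes "relational_language I ar"
    and "rel_structure I ar X R"
    and "Card_order lam" and "regularCard lam"
    and "natLeq \<le>o lam" and "lam \<le>o |X|"
    and "closure_operator X cl"
    and "\<phi>s \<in> Pc_less I ar X R lam"
    and "bad_condensation I ar X R \<phi>s"
    and "cl (Domain \<phi>s) = Domain \<phi>s"
    and "\<Pi> = {\<phi> \<in> Pc_less_above I ar X R ( |X| ) \<phi>s. cl (Domain \<phi>) = Domain \<phi>}"
    and bf1: "\<forall>\<phi>\<in>\<Pi>. \<forall>a\<in>X. \<exists>\<psi>\<in>\<Pi>. \<phi> \<subseteq> \<psi> \<and> a \<in> Domain \<psi> \<and> |\<psi> - \<phi>| <o lam"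
    and bf2: "\<forall>\<phi>\<in>\<Pi>. \<forall>b\<in>X. \<exists>\<psi>\<in>\<Pi>. \<phi> \<subseteq> \<psi> \<and> b \<in> Range \<psi> \<and> |\<psi> - \<phi>| <o lam"
  shows "\<not> reversible I ar X R"
proof -
  have \<Pi>: "\<phi> \<in> \<Pi> \<longleftrightarrow> \<phi> \<in> Pc I ar X R \<and> |\<phi>| <o |X| \<and> \<phi>s \<subseteq> \<phi> \<and> cl (Domain \<phi>) = Domain \<phi>" for \<phi>
    using assms(11) by (auto simp: Pc_less_above_def Pc_less_def)
  have \<phi>s: "\<phi>s \<in> Pc I ar X R" "|\<phi>s| <o lam" using assms(8) by (auto simp: Pc_less_def)
  then have base: "\<phi>s \<in> \<Pi>" using assms(6,10) ordLess_ordLeq_trans by (auto simp: \<Pi>)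
  \<comment> \<open>One stage applies \<open>bf1\<close> and then \<open>bf2\<close>; the two
    increments together stay below the infinite cardinal \<open>lam\<close>.\<close>
  have step: "\<exists>\<psi>\<in>\<Pi>. \<phi> \<subseteq> \<psi> \<and> (a \<in> Domain \<psi> \<and> a \<in> Range \<psi>) \<and> |\<psi> - \<phi>| <o lam"
    if \<phi>: "\<phi> \<in> \<Pi>" and a: "a \<in> X" for \<phi> a
  proof -
    obtain \<psi> where \<psi>: "\<psi> \<in> \<Pi>" "\<phi> \<subseteq> \<psi>" "a \<in> Domain \<psi>" "|\<psi> - \<phi>| <o lam" using bf1 \<phi> a by blast
    obtain \<chi> where \<chi>: "\<chi> \<in> \<Pi>" "\<psi> \<subseteq> \<chi>" "a \<in> Range \<chi>" "|\<chi> - \<psi>| <o lam" using bf2 \<psi>(1) a by blast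
    have "\<chi> - \<phi> = (\<chi> - \<psi>) \<union> (\<psi> - \<phi>)" using \<psi>(2) \<chi>(2) by blast
    then have "|\<chi> - \<phi>| <o lam"
      using card_of_Un_ordLess_infinite_Field[OF _ assms(3) \<chi>(4) \<psi>(4)]
        Cinfinite_if_natLeq[OF assms(3,5)] by (simp add: cinfinite_def)
    moreover have "\<phi> \<subseteq> \<chi>" "a \<in> Domain \<chi>" using \<psi>(2,3) \<chi>(2) by blast+
    ultimately show ?thesis using \<chi> by blast
  qed
  have lim: "(\<Union>j\<in>J. F j) \<in> \<Pi>"
    if J: "J \<noteq> {}" "|J| <o |X|" and ch: "subset.chain \<Pi> (F ` J)" and less: "|\<Union>j\<in>J. F j| <o |X|"
    for J :: "'a set" and F
  proof -
    have F: "F j \<in> \<Pi>" if "j \<in> J" for j using ch that by (auto simp: subset_chain_def)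
    have "subset.chain (Pc I ar X R) (F ` J)" using ch by (auto simp: subset_chain_def \<Pi>)
    then have "(\<Union>j\<in>J. F j) \<in> Pc I ar X R" using Pc_Union_chain J(1) by blast
    moreover have "\<phi>s \<subseteq> (\<Union>j\<in>J. F j)" using J(1) F \<Pi> by blast
    moreover have "cl (Domain (\<Union>j\<in>J. F j)) = Domain (\<Union>j\<in>J. F j)"
    proof -
      have "Domain (F j) \<subseteq> X \<and> |Domain (F j)| <o |X|" if "j \<in> J" for j
      proof -
        have "|Domain (F j)| \<le>o |F j|" unfolding Domain_fst by (rule card_of_image)
        then show ?thesis using F[OF that] ordLeq_ordLess_trans by (auto simp: \<Pi> Pc_def)
      qed
      \<comment> \<open>This is (cl2): there are fewer than \<open>|X|\<close> indices, and each
        domain is no larger than its graph.\<close>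
      then have "cl (\<Union>j\<in>J. Domain (F j)) = (\<Union>j\<in>J. cl (Domain (F j)))"
        using assms(7)[unfolded closure_operator_def, THEN conjunct2, THEN conjunct2, rule_format]
          J(2) by simp
      also have "\<dots> = (\<Union>j\<in>J. Domain (F j))" using F by (simp add: \<Pi>)
      finally show ?thesis by (simp add: Domain_Union)
    qed
    ultimately show ?thesis using less by (simp add: \<Pi>)
  qed
  obtain F where F: "subset.chain \<Pi> (F ` X)" "\<And>a. a \<in> X \<Longrightarrow> a \<in> Domain (F a) \<and> a \<in> Range (F a)"
    by (rule transfinite_chain[OF assms(3-6) base \<phi>s(2), where Q="\<lambda>a \<psi>. a \<in> Domain \<psi> \<and> a \<in> Range \<psi>"])
      (use step lim \<Pi> in blast)+
  \<comment> \<open>\<open>G\<close> will have full domain, so it leaves \<open>\<Pi>\<close>; only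
    membership in \<open>Pc\<close> survives, and that is enough.\<close>
  define G where "G = (\<Union>a\<in>X. F a)"
  have "X \<noteq> {}"
    using assms(5,6) infinite_iff_natLeq_ordLeq ordLeq_transitive by blast
  have "subset.chain (Pc I ar X R) (F ` X)" using F(1) by (auto simp: subset_chain_def \<Pi>)
  then have G: "G \<in> Pc I ar X R" unfolding G_def using Pc_Union_chain \<open>X \<noteq> {}\<close> by blast
  have sub: "\<phi>s \<subseteq> G"
    using F(1) \<open>X \<noteq> {}\<close> unfolding G_def by (fastforce simp: subset_chain_def \<Pi>)
  \<comment> \<open>Badness passes to extensions: the same tuple keeps its image under
    \<open>G\<close>.\<close>
  obtain i xs ys where bad: "i \<in> I" "xs \<in> nlists (ar i) (Domain \<phi>s)" "(xs, ys) \<in> listrel \<phi>s"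
    "xs \<notin> R i" "ys \<in> R i"
    using assms(9) by (auto simp: bad_condensation_def)
  have lr: "(xs, ys) \<in> listrel G" using bad(3) listrel_mono[OF sub] by blast
  have "xs \<in> nlists (ar i) (Domain G)"
    using nlistsE_length[OF bad(2)] listrel_set_Domain[OF lr] by (rule nlistsI)
  then have "bad_condensation I ar X R G"
    unfolding bad_condensation_def using G bad(1,4,5) lr
    by (intro conjI bexI[of _ i] bexI[of _ xs] exI[of _ ys])
  moreover have "Domain G = X" "Range G = X"
  proof -
    have "Domain G \<subseteq> X" "Range G \<subseteq> X" using G by (simp_all add: Pc_def)
    moreover have "X \<subseteq> Domain G" "X \<subseteq> Range G" using F(2) unfolding G_def by blast+
    ultimately show "Domain G = X" "Range G = X" by (simp_all add: subset_antisym)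
  qed
  ultimately show ?thesis by (rule not_reversible_if_total_bad_condensation)
qed

end
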